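(* Let $G$ be a nontrivial finite group. Then $G$ satisfies the strong CFS property (that is, every Lagrange subset of $G$ is a factor of $G$) if and only if $G$ is isomorphic either to a cyclic group of prime order, or to one of the four groups $C_4$, $C_2^2$, $C_2^3$, $C_3^2$.
   Context: Let $G$ be a finite group. A subset $A\subseteq G$ is called a Lagrange subset if $|A|$ divides $|G|$. A subset $A\subseteq G$ is called a (left) factor of $G$ if there exists a subset $B\subseteq G$ such that every element $x\in G$ can be written uniquely in the form $x=ab$ with $a\in A$, $b\in B$; equivalently, $G=\bigsqcup_{b\in B}Ab$ for some $B\subseteq G$, where $Ab=\{ab\mid a\in A\}$. A finite group $G$ has the strong CFS (converse of factorization by subsets) property if every Lagrange subset of $G$ is a factor of $G$. Here $C_n$ denotes the cyclic group of order $n$, and $C_n^k$ the direct product of $k$ copies of $C_n$. *)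

theory Defs
  imports "HOL-Algebra.Algebra"
begin

definition lagrange_subset :: "('a, 'b) monoid_scheme \<Rightarrow> 'a set \<Rightarrow> bool" where
  "lagrange_subset G A \<longleftrightarrow> A \<subseteq> carrier G \<and> card A dvd order G"

definition left_factor :: "('a, 'b) monoid_scheme \<Rightarrow> 'a set \<Rightarrow> bool" where
  "left_factor G A \<longleftrightarrow> A \<subseteq> carrier G \<and>
     (\<exists>B \<subseteq> carrier G. \<forall>x \<in> carrier G.
        \<exists>!p. p \<in> A \<times> B \<and> x = fst p \<otimes>\<^bsub>G\<^esub> snd p)"

definition strong_CFS :: "('a, 'b) monoid_scheme \<Rightarrow> bool" where
  "strong_CFS G \<longleftrightarrow> (\<forall>A. lagrange_subset G A \<longrightarrow> left_factor G A)"

end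

theory Submission
  imports Defs
begin

text \<open>
  The property fails as soon as a proper subgroup has more than four elements, and the reason
  is a perturbation argument. Let \<open>H\<close> be a proper subgroup and let \<open>A\<close> arise from \<open>H\<close> by exchanging
  a set \<open>D \<subseteq> H\<close> of fewer than half of its elements for a set \<open>Y\<close> of equally many elements outside
  \<open>H\<close>. If \<open>A\<close> is a factor with complement \<open>B\<close>, then \<open>A\<close> still contains more than half of \<open>H\<close>, which
  forces \<open>B\<close> to be a transversal of the right cosets of \<open>H\<close>; comparing the two factorizations
  \<open>A B = G = H B\<close> gives \<open>Y B = D B\<close> (lemma \<open>strong_CFS_swap\<close> records the inclusion that is
  used). This equation is very restrictive.

  With \<open>D = {\<one>}\<close> and \<open>Y = {y}\<close> it says that left multiplication by \<open>y\<close> permutes \<open>B\<close>, so that no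
  nontrivial power of \<open>y\<close> lies in \<open>H\<close> (\<open>strong_CFS_pow_in_subgroup\<close>); this is available for
  \<open>card H \<ge> 3\<close>. With \<open>D = {\<one>, h}\<close> and \<open>Y = {x, c x}\<close> for \<open>c \<in> H\<close> it says that the quotient \<open>c\<close> of two
  elements of \<open>Y b\<close> is a quotient of two elements of \<open>D\<close>, that is, \<open>h\<close> or its inverse. If
  \<open>card H \<ge> 5\<close>, then \<open>c\<close> can be chosen differently, so that every proper subgroup of a group with the
  property has at most four elements (\<open>strong_CFS_proper_subgroup_card\<close>).

  Moreover, a factor of the group that lies in a subgroup \<open>H\<close> is also a factor of \<open>H\<close>. If two primes
  \<open>p < q\<close> divide the order, a subset with \<open>p\<close> elements of a subgroup of order \<open>q\<close> is therefore not
  a factor. Hence the order is a prime power \<open>p ^ k\<close>, and by Sylow's theorem and the bound on proper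
  subgroups \<open>p ^ (k - 1) \<le> 4\<close>: the order is a prime, 4, 8 or 9. The statement on powers excludes
  elements of order greater than 2 from groups of order 8 and elements of order 9 from groups of order 9.
  The remaining groups are cyclic or elementary abelian.

  Conversely, one-element sets, the whole group and all cosets of subgroups are factors. This leaves
  the sets of size 2 in order 4, of size 4 in order 8 and of size 3 in order 9. In these cases there
  are too few quotients \<open>inv a \<otimes> a'\<close> with \<open>a, a' \<in> A\<close> to fill the group, and an element \<open>d\<close> that is not
  such a quotient yields the complement \<open>{\<one>, d}\<close> or \<open>{\<one>, d, inv d}\<close>
  (\<open>left_factor_if_few_differences\<close>).
\<close>

section \<open>Factorizations of a finite group\<close>

text \<open>
  In a finite group, uniqueness of the products and the right cardinality imply that the products
  cover the group.
\<close>

lemma (in group) left_factorI: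
  assumes fin: "finite (carrier G)" and A: "A \<subseteq> carrier G" and B: "B \<subseteq> carrier G"
    and card: "card A * card B = order G"
    and uniq: "\<And>a a' b b'. \<lbrakk>a \<in> A; a' \<in> A; b \<in> B; b' \<in> B; a \<otimes> b = a' \<otimes> b'\<rbrakk>
                 \<Longrightarrow> a = a' \<and> b = b'"
  shows "left_factor G A"
proof -
  let ?f = "\<lambda>p. fst p \<otimes> snd p"
  have inj: "inj_on ?f (A \<times> B)"
    by (rule inj_onI) (use uniq in \<open>auto simp: prod_eq_iff mem_Times_iff\<close>)
  have sub: "?f ` (A \<times> B) \<subseteq> carrier G"
    using A B by (intro image_subsetI m_closed) auto
  have "card (?f ` (A \<times> B)) = card (carrier G)"
    using card_image[OF inj] card by (simp add: card_cartesian_product order_def)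
  then have surj: "?f ` (A \<times> B) = carrier G"
    by (rule card_subset_eq[OF fin sub])
  have "\<exists>!p. p \<in> A \<times> B \<and> x = ?f p" if "x \<in> carrier G" for x
    using that inj unfolding surj[symmetric] inj_on_def by blast
  then show ?thesis
    unfolding left_factor_def using A B by blast
qed

lemma (in group) left_factorE:
  assumes "finite (carrier G)" and "left_factor G A"
  obtains B where "A \<subseteq> carrier G" "B \<subseteq> carrier G" "card A * card B = order G"
    and "\<And>a a' b b'. \<lbrakk>a \<in> A; a' \<in> A; b \<in> B; b' \<in> B; a \<otimes> b = a' \<otimes> b'\<rbrakk>
                 \<Longrightarrow> a = a' \<and> b = b'"
    and "\<And>x. x \<in> carrier G \<Longrightarrow> \<exists>a\<in>A. \<exists>b\<in>B. x = a \<otimes> b"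
proof -
  obtain B where A: "A \<subseteq> carrier G" and B: "B \<subseteq> carrier G"
    and ex: "\<forall>x\<in>carrier G. \<exists>!p. p \<in> A \<times> B \<and> x = fst p \<otimes> snd p"
    using assms(2) unfolding left_factor_def by (elim conjE exE)
  have uniq: "a = a' \<and> b = b'"
    if "a \<in> A" "a' \<in> A" "b \<in> B" "b' \<in> B" "a \<otimes> b = a' \<otimes> b'" for a a' b b'
  proof -
    have "a \<otimes> b \<in> carrier G"
      using that A B by auto
    from bspec[OF ex this] have "(a, b) = (a', b')"
      using that by (metis SigmaI fst_conv snd_conv)
    then show ?thesis by simp
  qed
  have img: "(\<lambda>p. fst p \<otimes> snd p) ` (A \<times> B) = carrier G"
  proof
    show "(\<lambda>p. fst p \<otimes> snd p) ` (A \<times> B) \<subseteq> carrier G"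
      using A B by (intro image_subsetI m_closed) auto
    show "carrier G \<subseteq> (\<lambda>p. fst p \<otimes> snd p) ` (A \<times> B)"
    proof
      fix x assume x: "x \<in> carrier G"
      obtain p where "p \<in> A \<times> B" "x = fst p \<otimes> snd p"
        using bspec[OF ex x] by (elim ex1E conjE)
      then show "x \<in> (\<lambda>p. fst p \<otimes> snd p) ` (A \<times> B)"
        by (rule rev_image_eqI)
    qed
  qed
  then have surj: "\<exists>a\<in>A. \<exists>b\<in>B. x = a \<otimes> b" if "x \<in> carrier G" for x
    using that unfolding img[symmetric] by fastforce
  have "inj_on (\<lambda>p. fst p \<otimes> snd p) (A \<times> B)"
    by (rule inj_onI) (use uniq in \<open>auto simp: prod_eq_iff mem_Times_iff\<close>)
  then have "bij_betw (\<lambda>p. fst p \<otimes> snd p) (A \<times> B) (carrier G)"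
    using img by (simp add: bij_betw_def)
  then have "card A * card B = order G"
    using bij_betw_same_card by (fastforce simp: order_def card_cartesian_product)
  then show ?thesis
    using that A B uniq surj by blast
qed

text \<open>
  The factor \<open>x\<close> on the left does not affect uniqueness of products, and any set of representatives of
  the right cosets of \<open>H\<close> complements \<open>H\<close>.
\<close>

lemma (in group) left_factor_translate_subgroup:
  assumes fin: "finite (carrier G)" and H: "subgroup H G" and x: "x \<in> carrier G"
  shows "left_factor G ((\<lambda>h. x \<otimes> h) ` H)"
proof -
  have HG: "H \<subseteq> carrier G"
    using H by (rule subgroup.subset)
  define r where "r = (\<lambda>R::'a set. SOME b. b \<in> R)"
  define B where "B = r ` (rcosets H)"
  have r: "r R \<in> R" if "R \<in> rcosets H" for R
    unfolding r_def using subgroup.rcosets_non_empty[OF H that] by (simp add: some_in_eq)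
  have rcoset: "H #> r R = R" if R: "R \<in> rcosets H" for R
  proof -
    obtain g where "g \<in> carrier G" "R = H #> g"
      using R by (auto simp: RCOSETS_def)
    then show ?thesis
      using repr_independence[of "r R" H g] r[OF R] H by auto
  qed
  have inj: "inj_on r (rcosets H)"
    by (metis inj_onI rcoset)
  have BG: "B \<subseteq> carrier G"
    unfolding B_def using r subgroup.rcosets_carrier[OF H is_group] by blast
  have xH: "inj_on (\<lambda>h. x \<otimes> h) H"
    using inj_on_cmult[OF x] HG by (rule inj_on_subset)
  show ?thesis
  proof (rule left_factorI[OF fin _ BG])
    show "(\<lambda>h. x \<otimes> h) ` H \<subseteq> carrier G"
      using x HG by auto
    show "card ((\<lambda>h. x \<otimes> h) ` H) * card B = order G"
      using lagrange[OF H] card_image[OF xH] card_image[OF inj] by (simp add: B_def mult.commute)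
  next
    fix a a' b b'
    assume "a \<in> (\<lambda>h. x \<otimes> h) ` H" "a' \<in> (\<lambda>h. x \<otimes> h) ` H" and b: "b \<in> B" "b' \<in> B"
      and eq: "a \<otimes> b = a' \<otimes> b'"
    then obtain h h' where h: "h \<in> H" "h' \<in> H" "a = x \<otimes> h" "a' = x \<otimes> h'"
      by auto
    have car: "h \<in> carrier G" "h' \<in> carrier G" "b \<in> carrier G" "b' \<in> carrier G"
      using h b HG BG by auto
    have hb: "h \<otimes> b = h' \<otimes> b'"
      using eq x car unfolding h by (simp add: m_assoc)
    have "H #> b = (H #> h) #> b"
      using coset_join2[of h H] H h car by simp
    also have "\<dots> = (H #> h') #> b'"
      using hb HG car by (simp add: coset_mult_assoc)
    also have "\<dots> = H #> b'"
      using coset_join2[of h' H] H h car by simp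
    finally have "b = b'"
      using b rcoset unfolding B_def by auto
    then show "a = a' \<and> b = b'"
      using hb car h by simp
  qed
qed

text \<open>
  The equation \<open>a \<otimes> b = a' \<otimes> b'\<close> is equivalent to \<open>inv a' \<otimes> a = b' \<otimes> inv b\<close>, so that uniqueness of
  products only depends on the sets of quotients of \<open>A\<close> and of \<open>B\<close>.
\<close>

lemma (in group) left_factor_if_differences_avoid:
  assumes fin: "finite (carrier G)" and A: "A \<subseteq> carrier G" and B: "B \<subseteq> carrier G"
    and card: "card A * card B = order G"
    and avoid: "\<And>a a' b b'. \<lbrakk>a \<in> A; a' \<in> A; b \<in> B; b' \<in> B; b \<noteq> b'\<rbrakk>
                 \<Longrightarrow> inv a \<otimes> a' \<noteq> b \<otimes> inv b'"
  shows "left_factor G A"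
proof (rule left_factorI[OF fin A B card])
  fix a a' b b'
  assume *: "a \<in> A" "a' \<in> A" "b \<in> B" "b' \<in> B" and eq: "a \<otimes> b = a' \<otimes> b'"
  have car: "a \<in> carrier G" "a' \<in> carrier G" "b \<in> carrier G" "b' \<in> carrier G"
    using * A B by auto
  have "a' = a \<otimes> b \<otimes> inv b'"
    using eq car by (simp add: inv_solve_right)
  then have "inv a \<otimes> a' = b \<otimes> inv b'"
    using car by (simp add: m_assoc inv_solve_left')
  then have "b = b'"
    using avoid * by blast
  then show "a = a' \<and> b = b'"
    using eq car by simp
qed

section \<open>Subgroups of a group with the strong CFS property\<close>

text \<open>
  If \<open>B\<close> complements \<open>A \<subseteq> H\<close> in the group, then \<open>B \<inter> H\<close> complements \<open>A\<close> in \<open>H\<close>: a product \<open>a \<otimes> b\<close>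
  with \<open>a \<in> H\<close> lies in \<open>H\<close> only if \<open>b\<close> does.
\<close>

lemma (in group) left_factor_in_subgroup_card_dvd:
  assumes fin: "finite (carrier G)" and H: "subgroup H G" and AH: "A \<subseteq> H"
    and fac: "left_factor G A"
  shows "card A dvd card H"
proof -
  have HG: "H \<subseteq> carrier G"
    using H by (rule subgroup.subset)
  from fin fac obtain B where B: "B \<subseteq> carrier G"
    and uniq: "\<And>a a' b b'. \<lbrakk>a \<in> A; a' \<in> A; b \<in> B; b' \<in> B; a \<otimes> b = a' \<otimes> b'\<rbrakk>
                 \<Longrightarrow> a = a' \<and> b = b'"
    and surj: "\<And>x. x \<in> carrier G \<Longrightarrow> \<exists>a\<in>A. \<exists>b\<in>B. x = a \<otimes> b"
    by (rule left_factorE) blast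
  have "bij_betw (\<lambda>p. fst p \<otimes> snd p) (A \<times> (B \<inter> H)) H"
    unfolding bij_betw_def
  proof
    show "inj_on (\<lambda>p. fst p \<otimes> snd p) (A \<times> (B \<inter> H))"
      by (rule inj_onI) (use uniq in \<open>auto simp: prod_eq_iff mem_Times_iff\<close>)
    have "x \<in> (\<lambda>p. fst p \<otimes> snd p) ` (A \<times> (B \<inter> H))" if x: "x \<in> H" for x
    proof -
      obtain a b where ab: "a \<in> A" "b \<in> B" "x = a \<otimes> b"
        using surj x HG by blast
      have "a \<in> carrier G" "b \<in> carrier G"
        using ab(1,2) AH HG B by auto
      then have "b = inv a \<otimes> x"
        unfolding ab(3) by (simp flip: m_assoc)
      moreover have "inv a \<otimes> x \<in> H"
        using x ab(1) AH by (intro subgroup.m_closed[OF H] subgroup.m_inv_closed[OF H]) auto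
      ultimately have "b \<in> H"
        by metis
      then show ?thesis
        using ab by (intro image_eqI[of _ _ "(a, b)"]) auto
    qed
    moreover have "(\<lambda>p. fst p \<otimes> snd p) ` (A \<times> (B \<inter> H)) \<subseteq> H"
      using AH by (intro image_subsetI subgroup.m_closed[OF H]) auto
    ultimately show "(\<lambda>p. fst p \<otimes> snd p) ` (A \<times> (B \<inter> H)) = H"
      by blast
  qed
  then have "card A * card (B \<inter> H) = card H"
    using bij_betw_same_card by (fastforce simp: card_cartesian_product)
  then show ?thesis
    by (metis dvd_triv_left)
qed

lemma (in group) strong_CFS_divisor_dvd_subgroup:
  assumes fin: "finite (carrier G)" and cfs: "strong_CFS G" and H: "subgroup H G"
    and d: "d dvd order G" "d \<le> card H"
  shows "d dvd card H"
proof -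
  obtain A where A: "A \<subseteq> H" "card A = d"
    using d(2) by (meson obtain_subset_with_card_n)
  then have "left_factor G A"
    using cfs d(1) subgroup.subset[OF H] by (auto simp: strong_CFS_def lagrange_subset_def)
  then show ?thesis
    using left_factor_in_subgroup_card_dvd[OF fin H] A by blast
qed

text \<open>
  The set \<open>A = (H - D) \<union> Y\<close> has as many elements as \<open>H\<close> and is therefore a factor; \<open>B\<close> is its
  complement. Two elements of \<open>B\<close> in the same right coset of \<open>H\<close> would give two translates of \<open>H - D\<close>
  inside that coset, and these intersect because \<open>H - D\<close> contains more than half of \<open>H\<close>. So \<open>H B\<close> is a
  factorization as well, and the products in \<open>Y B\<close> have to be among those of \<open>H B\<close> that \<open>(H - D) B\<close>
  does not use.
\<close>

lemma (in group) strong_CFS_swap: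
  assumes fin: "finite (carrier G)" and cfs: "strong_CFS G" and H: "subgroup H G"
    and D: "D \<subseteq> H" "2 * card D < card H"
    and Y: "Y \<subseteq> carrier G - H" "card Y = card D"
  obtains B where "B \<subseteq> carrier G" "B \<noteq> {}"
    and "\<And>h h' b b'. \<lbrakk>h \<in> H; h' \<in> H; b \<in> B; b' \<in> B; h \<otimes> b = h' \<otimes> b'\<rbrakk>
           \<Longrightarrow> h = h' \<and> b = b'"
    and "\<And>x b. \<lbrakk>x \<in> Y; b \<in> B\<rbrakk> \<Longrightarrow> \<exists>d\<in>D. \<exists>b'\<in>B. x \<otimes> b = d \<otimes> b'"
proof -
  interpret H: subgroup H G by (rule H)
  have HG: "H \<subseteq> carrier G"
    by (rule H.subset)
  have finH: "finite H" and finY: "finite Y"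
    using finite_subset[OF HG fin] finite_subset[OF Y(1)] fin by simp_all
  have finD: "finite D"
    using finH D finite_subset by blast
  define H' where "H' = H - D"
  define A where "A = H' \<union> Y"
  have H': "H' \<subseteq> H" "card H' = card H - card D"
    using D(1) finH finD by (auto simp: H'_def card_Diff_subset)
  have "card A = card H' + card Y"
    unfolding A_def using Y(1) H'(1) finH finY
    by (intro card_Un_disjoint) (auto simp: finite_subset)
  then have cardA: "card A = card H"
    using H' Y D by simp
  have "left_factor G A"
  proof -
    have "A \<subseteq> carrier G"
      unfolding A_def using Y H' HG by auto
    moreover have "card A dvd order G"
      unfolding cardA using lagrange[OF H] by (metis dvd_triv_right)
    ultimately show ?thesis
      using cfs unfolding strong_CFS_def lagrange_subset_def by blast
  qed
  with fin obtain B where B: "B \<subseteq> carrier G" and AG: "A \<subseteq> carrier G"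
    and cardB: "card A * card B = order G"
    and uniq: "\<And>a a' b b'. \<lbrakk>a \<in> A; a' \<in> A; b \<in> B; b' \<in> B; a \<otimes> b = a' \<otimes> b'\<rbrakk>
                 \<Longrightarrow> a = a' \<and> b = b'"
    by (rule left_factorE) blast
  have transversal: "h = h' \<and> b = b'"
    if hb: "h \<in> H" "h' \<in> H" "b \<in> B" "b' \<in> B" "h \<otimes> b = h' \<otimes> b'" for h h' b b'
  proof -
    have car: "h \<in> carrier G" "h' \<in> carrier G" "b \<in> carrier G" "b' \<in> carrier G"
      using hb HG B by auto
    \<comment> \<open>\<open>H' b\<close> and \<open>H' b' = H' k b\<close> are both subsets of \<open>H b\<close>; comparing \<open>H'\<close> with \<open>H' k\<close> in \<open>H\<close> suffices.\<close>
    define k where "k = inv h' \<otimes> h"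
    have k: "k \<in> H" "k \<in> carrier G"
      using hb car by (auto simp: k_def)
    have b': "b' = k \<otimes> b"
      using hb(5) car by (simp add: k_def m_assoc inv_solve_left)
    have inj: "inj_on (\<lambda>v. v \<otimes> k) H'"
      using inj_on_multc[OF k(2)] order_trans[OF H'(1) HG] by (rule inj_on_subset)
    have "H' \<inter> (\<lambda>v. v \<otimes> k) ` H' \<noteq> {}"
    proof
      assume disj: "H' \<inter> (\<lambda>v. v \<otimes> k) ` H' = {}"
      have "H' \<union> (\<lambda>v. v \<otimes> k) ` H' \<subseteq> H"
        using H'(1) k by auto
      from card_mono[OF finH this]
      have "card (H' \<union> (\<lambda>v. v \<otimes> k) ` H') \<le> card H" .
      moreover have "card (H' \<union> (\<lambda>v. v \<otimes> k) ` H') = card H' + card H'"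
        using card_image[OF inj] disj finite_subset[OF H'(1) finH]
        by (simp add: card_Un_disjoint)
      ultimately show False
        using H'(2) D(2) by linarith
    qed
    then obtain u v where uv: "u \<in> H'" "v \<in> H'" "u = v \<otimes> k"
      by auto
    have "u \<otimes> b = v \<otimes> b'"
      using uv H'(1) HG k car by (auto simp: b' m_assoc)
    then have "b = b'"
      using uniq[of u v b b'] uv hb by (auto simp: A_def)
    then show ?thesis
      using hb(5) car by simp
  qed
  have swap: "\<exists>d\<in>D. \<exists>b'\<in>B. x \<otimes> b = d \<otimes> b'" if x: "x \<in> Y" and b: "b \<in> B" for x b
  proof -
    let ?f = "\<lambda>p. fst p \<otimes> snd p"
    have inj: "inj_on ?f (H \<times> B)"
      by (rule inj_onI) (use transversal in \<open>auto simp: prod_eq_iff mem_Times_iff\<close>)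
    have sub: "?f ` (H \<times> B) \<subseteq> carrier G"
      using HG B by (intro image_subsetI m_closed) auto
    have "card (?f ` (H \<times> B)) = card (carrier G)"
      using card_image[OF inj] cardB cardA by (simp add: card_cartesian_product order_def)
    then have surj: "?f ` (H \<times> B) = carrier G"
      by (rule card_subset_eq[OF fin sub])
    have "x \<otimes> b \<in> carrier G"
      using x b Y(1) B by auto
    then have "x \<otimes> b \<in> ?f ` (H \<times> B)"
      unfolding surj .
    then obtain h b' where hb: "h \<in> H" "b' \<in> B" "x \<otimes> b = h \<otimes> b'"
      by auto
    have "h \<notin> H'"
    proof
      assume "h \<in> H'"
      then have "x = h"
        using uniq[of x h b b'] x b hb by (auto simp: A_def)
      then show False
        using x Y(1) hb by auto
    qed
    then show ?thesis
      using hb by (auto simp: H'_def)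
  qed
  have "B \<noteq> {}"
    using cardB order_gt_0_iff_finite fin by auto
  then show ?thesis
    using that B transversal swap by blast
qed

text \<open>
  Exchange \<open>\<one>\<close> for \<open>y\<close> in \<open>H\<close>. The resulting complement \<open>B\<close> is closed under left multiplication by
  \<open>y\<close>, so that \<open>b\<close> and \<open>y [^] k \<otimes> b\<close> both belong to \<open>B\<close>; if \<open>y [^] k \<in> H\<close>, they lie in the same right
  coset of \<open>H\<close> and have to be equal.
\<close>

lemma (in group) strong_CFS_pow_in_subgroup:
  assumes fin: "finite (carrier G)" and cfs: "strong_CFS G" and H: "subgroup H G"
    and "3 \<le> card H" and y: "y \<in> carrier G" "y \<notin> H" and k: "y [^] (k::nat) \<in> H"
  shows "y [^] k = \<one>"
proof -
  interpret H: subgroup H G by (rule H)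
  obtain B where B: "B \<subseteq> carrier G" "B \<noteq> {}"
    and uniq: "\<And>h h' b b'. \<lbrakk>h \<in> H; h' \<in> H; b \<in> B; b' \<in> B; h \<otimes> b = h' \<otimes> b'\<rbrakk>
           \<Longrightarrow> h = h' \<and> b = b'"
    and swap: "\<And>x b. \<lbrakk>x \<in> {y}; b \<in> B\<rbrakk> \<Longrightarrow> \<exists>d\<in>{\<one>}. \<exists>b'\<in>B. x \<otimes> b = d \<otimes> b'"
    using strong_CFS_swap[OF fin cfs H, of "{\<one>}" "{y}"] assms(4) y by auto
  have step: "y \<otimes> b \<in> B" if "b \<in> B" for b
    using swap[of y b] that B by auto
  have pow: "y [^] (n::nat) \<otimes> b \<in> B" if b: "b \<in> B" for n b
    using b
  proof (induction n arbitrary: b)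
    case 0
    then show ?case using B by auto
  next
    case (Suc n)
    then have "y [^] n \<otimes> (y \<otimes> b) \<in> B"
      using step by blast
    then show ?case
      using y Suc.prems B by (simp add: m_assoc subset_iff)
  qed
  obtain b where b: "b \<in> B"
    using B by auto
  have "y [^] k \<otimes> b = \<one> \<otimes> (y [^] k \<otimes> b)"
    using y b B by auto
  then show ?thesis
    using uniq[of "y [^] k" \<one> b "y [^] k \<otimes> b"] k b pow by auto
qed

text \<open>
  Exchange \<open>\<one>\<close> and \<open>h\<close> for \<open>x\<close> and \<open>c \<otimes> x\<close>, where \<open>x\<close> is outside \<open>H\<close>. The products \<open>x \<otimes> b\<close> and
  \<open>c \<otimes> x \<otimes> b\<close> lie in a common right coset of \<open>H\<close>, hence they are \<open>d \<otimes> b'\<close> and \<open>d' \<otimes> b'\<close> with the same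
  \<open>b'\<close> and \<open>d, d' \<in> {\<one>, h}\<close>. This forces \<open>c\<close> to be one of \<open>\<one>\<close>, \<open>h\<close> and \<open>inv h\<close>. The bound 5 is what allows
  two elements to be fewer than half of \<open>H\<close>; it also leaves room for another choice of \<open>c\<close>.
\<close>

lemma (in group) strong_CFS_proper_subgroup_card:
  assumes fin: "finite (carrier G)" and cfs: "strong_CFS G" and H: "subgroup H G"
    and "5 \<le> card H"
  shows "H = carrier G"
proof (rule ccontr)
  interpret H: subgroup H G by (rule H)
  assume "H \<noteq> carrier G"
  then obtain x where x: "x \<in> carrier G" "x \<notin> H"
    using H.subset by blast
  have finH: "finite H"
    using fin H.subset finite_subset by blast
  have ex: "\<exists>c\<in>H. c \<notin> S" if S: "finite S" "card S \<le> 3" for S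
  proof -
    have "\<not> H \<subseteq> S"
      using card_mono[OF S(1), of H] S(2) assms(4) by linarith
    then show ?thesis by blast
  qed
  obtain h where h: "h \<in> H" "h \<noteq> \<one>"
    using ex[of "{\<one>}"] by auto
  have "card {\<one>, h, inv h} \<le> 3"
    by (simp add: card_insert_if)
  then obtain c where c: "c \<in> H" "c \<noteq> \<one>" "c \<noteq> h" "c \<noteq> inv h"
    using ex[of "{\<one>, h, inv h}"] by auto
  have car: "h \<in> carrier G" "c \<in> carrier G"
    using h c by auto
  have "c \<otimes> x \<notin> H"
  proof
    assume "c \<otimes> x \<in> H"
    then have "inv c \<otimes> (c \<otimes> x) \<in> H"
      using c by blast
    then show False
      using x car by (simp add: m_assoc[symmetric])
  qed
  moreover have "c \<otimes> x \<noteq> x"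
    using c x car by simp
  ultimately obtain B where B: "B \<subseteq> carrier G" "B \<noteq> {}"
    and uniq: "\<And>h h' b b'. \<lbrakk>h \<in> H; h' \<in> H; b \<in> B; b' \<in> B; h \<otimes> b = h' \<otimes> b'\<rbrakk>
           \<Longrightarrow> h = h' \<and> b = b'"
    and swap: "\<And>z b. \<lbrakk>z \<in> {x, c \<otimes> x}; b \<in> B\<rbrakk>
           \<Longrightarrow> \<exists>d\<in>{\<one>, h}. \<exists>b'\<in>B. z \<otimes> b = d \<otimes> b'"
    using strong_CFS_swap[OF fin cfs H, of "{\<one>, h}" "{x, c \<otimes> x}"] assms(4) h x car
    by (auto simp: card_insert_if)
  obtain b where b: "b \<in> B" "b \<in> carrier G"
    using B by auto
  obtain d b' where d: "d \<in> {\<one>, h}" "b' \<in> B" "x \<otimes> b = d \<otimes> b'"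
    using swap[of x b] b by auto
  obtain d' b'' where d': "d' \<in> {\<one>, h}" "b'' \<in> B" "(c \<otimes> x) \<otimes> b = d' \<otimes> b''"
    using swap[of "c \<otimes> x" b] b by auto
  have dH: "d \<in> H" "d' \<in> H" "d \<in> carrier G" "d' \<in> carrier G" "b' \<in> carrier G"
    using d d' h car B by auto
  have "(c \<otimes> d) \<otimes> b' = d' \<otimes> b''"
    using d d' dH x car b by (metis m_assoc)
  then have "c \<otimes> d = d'"
    using uniq[of "c \<otimes> d" d' b' b''] d d' dH c by auto
  then have "c = d' \<otimes> inv d"
    using dH car by (simp add: inv_solve_right)
  then show False
    using d(1) d'(1) c car by auto
qed
text \<open>
  The square of every element belongs to a subgroup of index two, so that it has to be trivial for
  an element outside.
\<close>

lemma (in group) strong_CFS_index_two: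
  assumes fin: "finite (carrier G)" and cfs: "strong_CFS G" and H: "subgroup H G"
    and "3 \<le> card H" "order G = 2 * card H" and y: "y \<in> carrier G" "y \<notin> H"
  shows "y [^] (2::nat) = \<one>"
proof -
  interpret H: subgroup H G by (rule H)
  have "card (rcosets H) * card H = 2 * card H"
    using lagrange[OF H] assms(5) by simp
  then have two: "card (rcosets H) = 2"
    using assms(4) by simp
  let ?S = "{H, H #> y, H #> (y \<otimes> y)}"
  have "?S \<subseteq> rcosets H"
    using y H.subset by (auto intro: rcosetsI H.subgroup_in_rcosets)
  then have S: "card ?S \<le> 2"
    using two by (metis card_mono card.infinite zero_neq_numeral)
  have in_H: "u \<otimes> inv v \<in> H" if "H #> u = H #> v" "u \<in> carrier G" "v \<in> carrier G" for u v
  proof -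
    have "u \<in> H #> v"
      using rcos_self[OF that(2) H] that(1) by simp
    then show ?thesis
      using that H.subset by (auto simp: r_coset_def m_assoc)
  qed
  have H1: "H #> \<one> = H"
    by (simp add: H.subset)
  \<comment> \<open>Three cosets among two: two of them coincide, and the two pairs involving \<open>H #> y\<close> are impossible.\<close>
  have "H #> y \<noteq> H"
    using in_H[of y \<one>] y H1 by auto
  moreover have "H #> (y \<otimes> y) \<noteq> H #> y"
    using in_H[of "y \<otimes> y" y] y by (auto simp: m_assoc)
  ultimately have "H #> (y \<otimes> y) = H"
    using S by (auto simp: card_insert_if split: if_splits)
  then have "y \<otimes> y \<in> H"
    using in_H[of "y \<otimes> y" \<one>] y H1 by auto
  then have "y [^] (2::nat) \<in> H"
    using y by (simp add: numeral_2_eq_2)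
  then show ?thesis
    using strong_CFS_pow_in_subgroup[OF fin cfs H] assms(4) y by blast
qed

section \<open>The possible orders and exponents\<close>

lemma (in group) strong_CFS_prime_divisors_le:
  fixes p q :: nat
  assumes fin: "finite (carrier G)" and cfs: "strong_CFS G"
    and p: "Factorial_Ring.prime p" "p dvd order G"
    and q: "Factorial_Ring.prime q" "q dvd order G"
  shows "q \<le> p"
proof (rule ccontr)
  assume *: "\<not> q \<le> p"
  obtain H where H: "subgroup H G" "card H = q"
    using sylow_thm[of q G 1 "order G div q"] q fin is_group by auto
  have "p dvd q"
    using strong_CFS_divisor_dvd_subgroup[OF fin cfs H(1) p(2)] H(2) * by simp
  then show False
    using p(1) q(1) * primes_dvd_imp_eq by blast
qed

lemma (in group) strong_CFS_order_cases:
  assumes fin: "finite (carrier G)" and cfs: "strong_CFS G" and "order G \<noteq> 1"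
  shows "Factorial_Ring.prime (order G) \<or> order G = 4 \<or> order G = 8 \<or> order G = 9"
proof -
  have pos: "order G > 0"
    using fin order_gt_0_iff_finite by blast
  obtain p where p: "Factorial_Ring.prime p" "p dvd order G"
    using prime_factor_nat[OF assms(3)] by blast
  define k where "k = multiplicity p (order G)"
  have "order G \<noteq> 0" "\<not> p dvd 1"
    using pos p(1) by auto
  then obtain m where m: "order G = p ^ k * m" "\<not> p dvd m"
    unfolding k_def using p(1) multiplicity_decompose'[of "order G" p] by (metis not_prime_unit)
  have "m = 1"
  proof (rule ccontr)
    assume "m \<noteq> 1"
    then obtain q where q: "Factorial_Ring.prime q" "q dvd m"
      using prime_factor_nat by blast
    then have "q dvd order G"
      using m(1) by simp
    then have "q = p"
      using strong_CFS_prime_divisors_le[OF fin cfs] p q by (simp add: antisym)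
    then show False
      using q m by simp
  qed
  then have n: "order G = p ^ k"
    using m by simp
  have "k \<noteq> 0"
    using n assms(3) by (metis power_0)
  then consider "k = 1" | j where "k = Suc j" "j \<ge> 1"
    by (metis One_nat_def Suc_le_eq neq0_conv not0_implies_Suc)
  then show ?thesis
  proof cases
    case 1
    then show ?thesis
      using p n by simp
  next
    case 2
    have p2: "p \<ge> 2"
      using p(1) by (rule prime_ge_2_nat)
    have "order G = p ^ j * p"
      using n 2 by simp
    then obtain H where H: "subgroup H G" "card H = p ^ j"
      using sylow_thm[OF p(1) is_group _ fin] by blast
    have "card H \<noteq> order G"
      using H(2) n 2 p2 by simp
    then have small: "p ^ j < 5"
      using strong_CFS_proper_subgroup_card[OF fin cfs H(1)] H(2)
      by (force simp: order_def)
    have "2 ^ j \<le> p ^ j"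
      using p2 by (rule power_mono) simp
    then have "(2::nat) ^ j < 2 ^ 3"
      using small by simp
    then have j: "j < 3"
      by (rule power_less_imp_less_exp[rotated]) simp
    have "p \<le> p ^ j"
      using 2 p2 by (intro self_le_power) auto
    then have p5: "p < 5"
      using small by simp
    have "p \<noteq> 4"
    proof
      assume "p = 4"
      then have "(2::nat) dvd p" by simp
      then show False
        using p(1) \<open>p = 4\<close> primes_dvd_imp_eq[OF two_is_prime_nat p(1)] by simp
    qed
    then have "p = 2 \<or> p = 3"
      using p2 p5 by linarith
    moreover have "j = 1 \<or> j = 2"
      using j 2 by linarith
    ultimately show ?thesis
      using small n 2 by (auto simp: numeral_eq_Suc)
  qed
qed

text \<open>
  Elements outside a subgroup of order 4 are involutions. So if \<open>y\<close> is not, it lies in every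
  subgroup of order 4. But its square \<open>z\<close> is an involution that commutes with any involution \<open>s\<close> outside a
  given subgroup \<open>H\<close> of order 4, since conjugation by \<open>s\<close> inverts \<open>y\<close>; the four-group generated by
  \<open>z\<close> and \<open>s\<close> does not contain \<open>y\<close>.
\<close>

lemma (in group) strong_CFS_order_8_exponent:
  assumes fin: "finite (carrier G)" and cfs: "strong_CFS G" and n: "order G = 8"
    and y: "y \<in> carrier G"
  shows "y [^] (2::nat) = \<one>"
proof (rule ccontr)
  assume y2: "y [^] (2::nat) \<noteq> \<one>"
  have sq: "x [^] (2::nat) = x \<otimes> x" if "x \<in> carrier G" for x
    using that by (simp add: numeral_2_eq_2)
  obtain H where H: "subgroup H G" "card H = 4"
    using sylow_thm[OF two_is_prime_nat is_group _ fin, of 2 2] n by auto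
  interpret H: subgroup H G by (rule H)
  have outside: "x [^] (2::nat) = \<one>"
    if "subgroup K G" "card K = 4" "x \<in> carrier G" "x \<notin> K" for K x
    using strong_CFS_index_two[OF fin cfs that(1)] that n by simp
  have yH: "y \<in> H"
    using outside[OF H y] y2 by blast
  have "y [^]\<^bsub>G\<lparr>carrier := H\<rparr>\<^esub> order (G\<lparr>carrier := H\<rparr>) = \<one>\<^bsub>G\<lparr>carrier := H\<rparr>\<^esub>"
    using group.pow_order_eq_1[OF subgroup.subgroup_is_group[OF H(1) is_group]] yH
    by simp
  then have y4: "y [^] (4::nat) = \<one>"
    using H(2) by (simp add: order_def flip: nat_pow_consistent)
  define z where "z = y \<otimes> y"
  have z: "z \<in> carrier G" "z \<in> H" "z \<noteq> \<one>"
    using y yH y2 sq by (auto simp: z_def)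
  have zz: "z \<otimes> z = \<one>"
    using y4 y by (simp add: z_def numeral_eq_Suc m_assoc)
  have "\<not> carrier G \<subseteq> H"
  proof
    assume "carrier G \<subseteq> H"
    then have "carrier G = H"
      using H.subset by blast
    then show False
      using n H(2) by (simp add: order_def)
  qed
  then obtain s where s: "s \<in> carrier G" "s \<notin> H"
    by blast
  have ss: "s \<otimes> s = \<one>"
    using outside[OF H s] sq s by simp
  have not_in: "s \<otimes> h \<notin> H" if "h \<in> H" for h
  proof
    assume "s \<otimes> h \<in> H"
    then have "(s \<otimes> h) \<otimes> inv h \<in> H"
      using that by blast
    then show False
      using s that H.mem_carrier by (simp add: m_assoc)
  qed
  have "(s \<otimes> y) \<otimes> (s \<otimes> y) = \<one>"
    using outside[OF H, of "s \<otimes> y"] not_in[OF yH] s y sq by simp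
  then have sys: "s \<otimes> y \<otimes> s = inv y"
    using s y by (intro inv_equality[symmetric]) (simp_all add: m_assoc)
  have sz: "s \<otimes> z = z \<otimes> s"
  proof -
    have "s \<otimes> z \<otimes> s = (s \<otimes> y \<otimes> s) \<otimes> (s \<otimes> y \<otimes> s)"
    proof -
      have "(s \<otimes> y \<otimes> s) \<otimes> (s \<otimes> y \<otimes> s) = s \<otimes> y \<otimes> (s \<otimes> s) \<otimes> y \<otimes> s"
        using s y by (simp add: m_assoc)
      then show ?thesis
        using s y ss by (simp add: z_def m_assoc)
    qed
    also have "\<dots> = inv z"
      using y unfolding sys z_def by (simp add: inv_mult_group)
    also have "\<dots> = z"
      using zz z by (simp add: inv_equality)
    finally have szs: "s \<otimes> z \<otimes> s = z" .
    have "s \<otimes> z = s \<otimes> z \<otimes> (s \<otimes> s)"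
      using s z ss by simp
    also have "\<dots> = s \<otimes> z \<otimes> s \<otimes> s"
      using s z by (simp add: m_assoc)
    finally show ?thesis
      unfolding szs .
  qed
  define K where "K = {\<one>, z, s, s \<otimes> z}"
  have zsz: "z \<otimes> (s \<otimes> z) = s" "s \<otimes> (s \<otimes> z) = z" "s \<otimes> z \<otimes> z = s"
    "s \<otimes> z \<otimes> s = z" "s \<otimes> z \<otimes> (s \<otimes> z) = \<one>"
  proof -
    have "s \<otimes> (s \<otimes> u) = u" "z \<otimes> (z \<otimes> u) = u" "z \<otimes> (s \<otimes> u) = s \<otimes> (z \<otimes> u)"
      if "u \<in> carrier G" for u
      using that s z ss zz sz by (simp_all flip: m_assoc)
    then show "z \<otimes> (s \<otimes> z) = s" "s \<otimes> (s \<otimes> z) = z" "s \<otimes> z \<otimes> z = s"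
      "s \<otimes> z \<otimes> s = z" "s \<otimes> z \<otimes> (s \<otimes> z) = \<one>"
      using s z ss zz by (simp_all add: m_assoc sz[symmetric])
  qed
  have K: "subgroup K G"
  proof (rule subgroupI)
    show "inv x \<in> K" if "x \<in> K" for x
    proof -
      have "x \<otimes> x = \<one>" "x \<in> carrier G"
        using that s z ss zz zsz by (auto simp: K_def)
      then show ?thesis
        using that by (simp add: inv_equality)
    qed
    show "x \<otimes> x' \<in> K" if "x \<in> K" "x' \<in> K" for x x'
      using that s(1) z(1) ss zz zsz sz[symmetric] unfolding K_def
      by (elim insertE emptyE) simp_all
  qed (use s z in \<open>auto simp: K_def\<close>)
  have sz_notin: "s \<otimes> z \<notin> H"
    using not_in z by blast
  have "card K = 4"
  proof -
    have "\<one> \<noteq> s" "\<one> \<noteq> s \<otimes> z" "z \<noteq> s" "z \<noteq> s \<otimes> z"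
      using s(2) sz_notin H.one_closed z(2) by metis+
    moreover have "s \<noteq> s \<otimes> z"
      using s(1) z(1,3) by (metis l_cancel one_closed r_one)
    ultimately show ?thesis
      using z(3) by (simp add: K_def)
  qed
  moreover have "y \<notin> K"
  proof -
    have "y \<noteq> \<one>" "y \<noteq> z" "y \<noteq> s" "y \<noteq> s \<otimes> z"
      using y y2 z s yH sz_notin by (auto simp: z_def)
    then show ?thesis
      by (simp add: K_def)
  qed
  ultimately show False
    using outside[OF K _ y] y2 by blast
qed

text \<open>
  An element of order 9 would lie outside the subgroup of order 3 generated by its cube, although
  its cube is a nontrivial power in that subgroup.
\<close>

lemma (in group) strong_CFS_order_9_exponent:
  assumes fin: "finite (carrier G)" and cfs: "strong_CFS G" and n: "order G = 9"
    and y: "y \<in> carrier G"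
  shows "y [^] (3::nat) = \<one>"
proof (rule ccontr)
  assume y3: "y [^] (3::nat) \<noteq> \<one>"
  have "ord y dvd 3 ^ 2"
    using ord_dvd_group_order[OF y] n by simp
  then obtain i where i: "i \<le> 2" "ord y = 3 ^ i"
    using divides_primepow_nat[of 3 "ord y" 2] by auto
  have "\<not> ord y dvd 3"
    using y3 y pow_eq_id by blast
  then have "i \<noteq> 0" "i \<noteq> 1"
    using i(2) by (metis one_dvd power_0, metis dvd_refl power_one_right)
  then have ord: "ord y = 9"
    using i by (cases "i = 2") auto
  define H where "H = generate G {y [^] (3::nat)}"
  have H: "subgroup H G"
    unfolding H_def using y by (intro generate_is_subgroup) auto
  have cardH: "card H = 3"
    unfolding H_def using y ord ord_pow[of y 3] by (simp flip: generate_pow_card)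
  have "y \<notin> H"
  proof
    assume "y \<in> H"
    then have "generate G {y} \<subseteq> H"
      using generate_subgroup_incl[of "{y}" H] H by simp
    moreover have "finite H"
      using cardH card.infinite by fastforce
    ultimately have "card (generate G {y}) \<le> card H"
      by (simp add: card_mono)
    then show False
      using generate_pow_card[OF y] ord cardH by simp
  qed
  moreover have "y [^] (3::nat) \<in> H"
    unfolding H_def by (simp add: generate.incl)
  ultimately show False
    using strong_CFS_pow_in_subgroup[OF fin cfs H _ y] cardH y3 by simp
qed

section \<open>Recognizing the groups\<close>

lemma (in group) comm_group_if_exponent_2:
  assumes "\<And>x. x \<in> carrier G \<Longrightarrow> x [^] (2::nat) = \<one>"
  shows "comm_group G"
proof (rule group_comm_groupI)
  have inv: "inv x = x" if "x \<in> carrier G" for x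
    using assms[OF that] that by (intro inv_equality) (auto simp: numeral_2_eq_2)
  fix x y assume "x \<in> carrier G" "y \<in> carrier G"
  then show "x \<otimes> y = y \<otimes> x"
    using inv[of "x \<otimes> y"] inv[of x] inv[of y] by (simp add: inv_mult_group)
qed

text \<open>
  If \<open>x\<close> and \<open>y\<close> do not commute, the nine products \<open>x\<^sup>i y\<^sup>j\<close> exhaust the group, because
  \<open>y\<close> and its square lie outside the subgroup generated by \<open>x\<close>. Then \<open>y \<otimes> x\<close> is one of them, and each possibility
  contradicts \<open>(y \<otimes> x)\<^sup>3 = \<one>\<close>, a cancellation law, or the choice of \<open>x\<close> and \<open>y\<close>.
\<close>

lemma (in group) comm_group_if_order_9_exponent_3:
  assumes fin: "finite (carrier G)" and n: "order G = 9"
    and exp3: "\<And>x. x \<in> carrier G \<Longrightarrow> x [^] (3::nat) = \<one>"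
  shows "comm_group G"
proof (rule group_comm_groupI)
  have cube: "x \<otimes> (x \<otimes> x) = \<one>" if "x \<in> carrier G" for x
    using exp3[OF that] that by (simp add: numeral_3_eq_3 m_assoc)
  fix x y assume x: "x \<in> carrier G" and y: "y \<in> carrier G"
  show "x \<otimes> y = y \<otimes> x"
  proof (rule ccontr)
    assume nc: "x \<otimes> y \<noteq> y \<otimes> x"
    define H where "H = {\<one>, x, x \<otimes> x}"
    have xne: "x \<noteq> \<one>" "y \<noteq> \<one>"
      using nc x y by auto
    have xx: "x \<otimes> x \<noteq> \<one>" "x \<otimes> x \<noteq> x"
      using cube[OF x] x xne by auto
    have H: "subgroup H G"
    proof (rule subgroupI)
      have "inv x = x \<otimes> x" "inv (x \<otimes> x) = x"
        using cube[OF x] x by (auto intro!: inv_equality simp: m_assoc)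
      then show "inv h \<in> H" if "h \<in> H" for h
        using that by (auto simp: H_def)
      have "x \<otimes> x \<otimes> x = \<one>" "x \<otimes> x \<otimes> (x \<otimes> x) = x"
        using cube[OF x] x by (auto simp: m_assoc)
      then show "h \<otimes> h' \<in> H" if "h \<in> H" "h' \<in> H" for h h'
        using that cube[OF x] x by (auto simp: H_def)
    qed (use x in \<open>auto simp: H_def\<close>)
    interpret H: subgroup H G by (rule H)
    have cardH: "card H = 3"
      unfolding card_3_iff H_def using xne(1) xx
      by (intro exI[of _ \<one>] exI[of _ x] exI[of _ "x \<otimes> x"]) simp
    have comm: "x \<otimes> h = h \<otimes> x" if "h \<in> H" for h
      using that x unfolding H_def by (elim insertE emptyE) (simp_all add: m_assoc)
    have yH: "y \<notin> H"
      using comm nc by blast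
    have yyH: "y \<otimes> y \<notin> H"
    proof
      assume "y \<otimes> y \<in> H"
      then have "(y \<otimes> y) \<otimes> (y \<otimes> y) \<in> H"
        by blast
      moreover have "(y \<otimes> y) \<otimes> (y \<otimes> y) = y"
        using cube[OF y] y by (simp add: m_assoc)
      ultimately show False
        using yH by simp
    qed
    have mem: "v \<otimes> inv w \<in> H" if "H #> v = H #> w" "v \<in> carrier G" "w \<in> carrier G" for v w
    proof -
      have "v \<in> H #> w"
        using rcos_self[OF that(2) H] that(1) by simp
      then show ?thesis
        using that H.subset by (auto simp: r_coset_def m_assoc)
    qed
    have ne: "H #> \<one> \<noteq> H #> y" "H #> \<one> \<noteq> H #> (y \<otimes> y)" "H #> y \<noteq> H #> (y \<otimes> y)"
      using mem[of y \<one>] mem[of "y \<otimes> y" \<one>] mem[of "y \<otimes> y" y] x y yH yyH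
      by (auto simp: m_assoc)
    let ?S = "{H #> \<one>, H #> y, H #> (y \<otimes> y)}"
    have card_r: "card (rcosets H) = 3"
      using lagrange[OF H] n cardH by simp
    have "?S = rcosets H"
    proof (rule card_subset_eq)
      show "finite (rcosets H)"
        using card_r card.infinite by fastforce
      show "?S \<subseteq> rcosets H"
        using y H.subset H.subgroup_in_rcosets[OF is_group] by (auto intro: rcosetsI)
      show "card ?S = card (rcosets H)"
        using ne card_r by simp
    qed
    moreover have "H #> (y \<otimes> x) \<in> rcosets H"
      using x y H.subset by (auto intro!: rcosetsI)
    moreover have "y \<otimes> x \<in> H #> (y \<otimes> x)"
      using rcos_self[OF _ H] x y by simp
    ultimately have "y \<otimes> x \<in> H #> \<one> \<or> y \<otimes> x \<in> H #> y \<or> y \<otimes> x \<in> H #> (y \<otimes> y)"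
      by auto
    then obtain b where b: "b \<in> {\<one>, y, y \<otimes> y}" "y \<otimes> x \<in> H #> b"
      by blast
    then obtain h where h: "h \<in> H" "y \<otimes> x = h \<otimes> b"
      unfolding r_coset_def by blast
    then have cases: "y \<otimes> x = h \<or> y \<otimes> x = h \<otimes> y \<or> y \<otimes> x = h \<otimes> (y \<otimes> y)"
      using b(1) H.mem_carrier[OF h(1)] by (elim insertE emptyE) simp_all
    have "y \<otimes> x \<noteq> h"
    proof
      assume "y \<otimes> x = h"
      then have "y = h \<otimes> inv x"
        using inv_solve_right[OF y H.mem_carrier[OF h(1)] x] by metis
      moreover have "x \<in> H"
        unfolding H_def by blast
      ultimately show False
        using h yH by blast
    qed
    have yx3: "(y \<otimes> x) \<otimes> ((y \<otimes> x) \<otimes> (y \<otimes> x)) = \<one>"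
      using cube x y by simp
    have "y \<otimes> x \<noteq> y"  "y \<otimes> x \<noteq> y \<otimes> y"
      using x y xne nc by auto
    moreover have "y \<otimes> x \<noteq> x \<otimes> (y \<otimes> y)"
    proof
      assume eq: "y \<otimes> x = x \<otimes> (y \<otimes> y)"
      have "\<one> = (y \<otimes> x) \<otimes> ((y \<otimes> x) \<otimes> (y \<otimes> x))"
        using yx3 by simp
      also have "\<dots> = x \<otimes> (y \<otimes> (y \<otimes> y)) \<otimes> x \<otimes> (y \<otimes> x)"
        using x y by (subst eq) (simp add: m_assoc)
      also have "\<dots> = x \<otimes> x \<otimes> (x \<otimes> (y \<otimes> y))"
        using x y cube[OF y] eq by simp
      also have "\<dots> = x \<otimes> (x \<otimes> x) \<otimes> (y \<otimes> y)"
        using x y by (simp add: m_assoc)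
      also have "\<dots> = y \<otimes> y"
        using x y cube[OF x] by simp
      finally show False
        using cube[OF y] y xne by (metis r_one)
    qed
    moreover have "y \<otimes> x \<noteq> x \<otimes> x \<otimes> y"
    proof
      assume eq: "y \<otimes> x = x \<otimes> x \<otimes> y"
      have "\<one> = (y \<otimes> x) \<otimes> ((y \<otimes> x) \<otimes> (y \<otimes> x))"
        using yx3 by simp
      also have "\<dots> = (y \<otimes> x) \<otimes> ((y \<otimes> x) \<otimes> (x \<otimes> x \<otimes> y))"
        using eq by simp
      also have "\<dots> = (y \<otimes> x) \<otimes> (y \<otimes> (x \<otimes> (x \<otimes> x)) \<otimes> y)"
        using x y by (simp add: m_assoc)
      also have "\<dots> = (x \<otimes> x \<otimes> y) \<otimes> (y \<otimes> y)"
        using x y cube[OF x] eq by simp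
      also have "\<dots> = x \<otimes> x \<otimes> (y \<otimes> (y \<otimes> y))"
        using x y by (simp add: m_assoc)
      also have "\<dots> = x \<otimes> x"
        using x cube[OF y] by simp
      finally show False
        using xx by simp
    qed
    moreover have "y \<otimes> x \<noteq> x \<otimes> x \<otimes> (y \<otimes> y)"
    proof
      assume eq: "y \<otimes> x = x \<otimes> x \<otimes> (y \<otimes> y)"
      have "(y \<otimes> x) \<otimes> (y \<otimes> x) = x \<otimes> x \<otimes> (y \<otimes> y) \<otimes> (y \<otimes> x)"
        using eq by simp
      also have "\<dots> = x \<otimes> x \<otimes> (y \<otimes> (y \<otimes> y)) \<otimes> x"
        using x y by (simp add: m_assoc)
      also have "\<dots> = \<one>"
        using x cube[OF x] cube[OF y] by (simp add: m_assoc)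
      finally have "y \<otimes> x = \<one>"
        using yx3 x y by simp
      then have "y = inv x"
        using x y by (simp add: inv_equality)
      then show False
        using nc x by simp
    qed
    moreover have "h = \<one> \<or> h = x \<or> h = x \<otimes> x"
      using h(1) unfolding H_def by blast
    ultimately show False
      using cases \<open>y \<otimes> x \<noteq> h\<close> nc by (metis l_one m_closed y)
  qed
qed

lemma (in group) int_pow_mod_cong:
  assumes "x \<in> carrier G" "x [^] n = \<one>"
  shows "x [^] (i mod int n) = x [^] i"
proof -
  have "int (ord x) dvd int n"
    using assms pow_eq_id by simp
  moreover have "int n dvd i - i mod int n"
    by (simp add: minus_mod_eq_mult_div)
  ultimately have "int (ord x) dvd i - i mod int n"
    by (rule dvd_trans)
  then show ?thesis
    using int_pow_eq[OF assms(1)] by blast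
qed

lemma integer_mod_group_eqI:
  assumes "int n dvd j - i" "i \<in> carrier (integer_mod_group n)" "j \<in> carrier (integer_mod_group n)"
    "n > 0"
  shows "i = j"
proof -
  have "0 \<le> i" "i < int n" "0 \<le> j" "j < int n"
    using assms(2-4) by (auto simp: carrier_integer_mod_group)
  moreover have "j mod int n = i mod int n"
    using assms(1) by (simp add: mod_eq_dvd_iff)
  ultimately show ?thesis
    by simp
qed

lemma (in group) powers_mon:
  assumes x: "x \<in> carrier G" and n: "ord x = n" "n > 0"
  shows "(\<lambda>i::int. x [^] i) \<in> mon (integer_mod_group n) G"
proof -
  have x1: "x [^] n = \<one>"
    using x n(1) by auto
  have "(\<lambda>i::int. x [^] i) \<in> hom (integer_mod_group n) G"
    using x by (intro homI) (simp_all add: int_pow_mod_cong[OF x x1] int_pow_mult)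
  moreover have "inj_on (\<lambda>i::int. x [^] i) (carrier (integer_mod_group n))"
  proof (rule inj_onI)
    fix i j :: int
    assume ij: "i \<in> carrier (integer_mod_group n)" "j \<in> carrier (integer_mod_group n)"
      and "x [^] i = x [^] j"
    then have "int n dvd j - i"
      using x n(1) int_pow_eq by blast
    then show "i = j"
      using ij n(2) by (rule integer_mod_group_eqI)
  qed
  ultimately show ?thesis
    by (simp add: mon_def)
qed

lemma (in group) iso_if_mon:
  assumes fin: "finite (carrier G)" and K: "group K" and f: "f \<in> mon K G"
    and card: "order K = order G"
  shows "G \<cong> K"
proof -
  have "f ` carrier K = carrier G"
  proof (rule card_subset_eq[OF fin])
    show "f ` carrier K \<subseteq> carrier G"
      using f by (auto simp: mon_def hom_def)
    show "card (f ` carrier K) = card (carrier G)"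
      using f card by (simp add: mon_def card_image order_def)
  qed
  then have "f \<in> iso K G"
    using f by (simp add: mon_def Group.iso_iff)
  then have "K \<cong> G"
    by (rule is_isoI)
  then show ?thesis
    by (rule group.iso_sym[OF K])
qed

text \<open>
  Elementary abelian groups are recognized by adding one cyclic factor at a time. Injectivity
  holds because the intersection of the image of \<open>f\<close> with the group of order \<open>p\<close> generated by
  \<open>a\<close> is trivial: otherwise a power of \<open>a\<close> with exponent prime to \<open>p\<close> is in the image, and by Bezout so is \<open>a\<close>.
\<close>

lemma (in comm_group) extend_mon:
  assumes K: "group K" and f: "f \<in> mon K G" and p: "Factorial_Ring.prime p"
    and a: "a \<in> carrier G" "a [^] p = \<one>" "a \<notin> f ` carrier K"
  shows "(\<lambda>(i::int, k). a [^] i \<otimes> f k) \<in> mon (integer_mod_group p \<times>\<times> K) G"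
proof -
  have fhom: "f \<in> hom K G" and finj: "inj_on f (carrier K)"
    using f by (auto simp: mon_def)
  interpret f: group_hom K G f
    using K fhom is_group by (simp add: group_hom_def group_hom_axioms_def)
  let ?g = "\<lambda>(i::int, k). a [^] i \<otimes> f k"
  have "?g \<in> hom (integer_mod_group p \<times>\<times> K) G"
  proof (rule homI)
    fix u v
    assume "u \<in> carrier (integer_mod_group p \<times>\<times> K)" "v \<in> carrier (integer_mod_group p \<times>\<times> K)"
    then obtain i k j l where uv: "u = (i, k)" "v = (j, l)" "k \<in> carrier K" "l \<in> carrier K"
      by (auto simp: DirProd_def)
    have "a [^] (i + j) \<otimes> (f k \<otimes> f l) = (a [^] i \<otimes> f k) \<otimes> (a [^] j \<otimes> f l)"
      using uv a(1) by (simp add: int_pow_mult m_ac)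
    then show "?g (u \<otimes>\<^bsub>integer_mod_group p \<times>\<times> K\<^esub> v) = ?g u \<otimes> ?g v"
      using uv by (simp add: int_pow_mod_cong[OF a(1,2)])
  qed (use a in \<open>auto simp: DirProd_def\<close>)
  moreover have "inj_on ?g (carrier (integer_mod_group p \<times>\<times> K))"
  proof (rule inj_onI)
    fix u v
    assume "u \<in> carrier (integer_mod_group p \<times>\<times> K)" "v \<in> carrier (integer_mod_group p \<times>\<times> K)"
      and eq: "?g u = ?g v"
    then obtain i k j l where uv: "u = (i, k)" "v = (j, l)" and kl: "k \<in> carrier K" "l \<in> carrier K"
      and ij: "i \<in> carrier (integer_mod_group p)" "j \<in> carrier (integer_mod_group p)"
      by (auto simp: DirProd_def)
    define c where "c = a [^] (i - j)"
    have eq': "a [^] i \<otimes> f k = a [^] j \<otimes> f l"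
      using eq uv by simp
    have "a [^] i = a [^] j \<otimes> c"
      using a(1) by (simp add: c_def flip: int_pow_mult)
    then have "a [^] j \<otimes> (c \<otimes> f k) = a [^] j \<otimes> f l"
      using eq' a(1) kl by (simp add: c_def m_assoc)
    then have "c \<otimes> f k = f l"
      using a(1) kl by (simp add: c_def)
    then have "c = f l \<otimes> inv (f k)"
      using a(1) kl by (simp add: c_def inv_solve_right)
    then have c: "c = f (l \<otimes>\<^bsub>K\<^esub> inv\<^bsub>K\<^esub> k)"
      using kl by simp
    have "int p dvd i - j"
    proof (rule ccontr)
      assume "\<not> int p dvd i - j"
      then have "coprime (int p) (i - j)"
        using p by (intro prime_imp_coprime) auto
      then obtain r s where rs: "r * int p + s * (i - j) = 1"
        using bezout_int[of "int p" "i - j"] by (auto simp: coprime_iff_gcd_eq_1)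
      have "a [^] (int p * r) = \<one>"
        using a by (simp add: int_pow_pow[symmetric] int_pow_int)
      moreover have "a [^] (int p * r + (i - j) * s) = a"
        using rs a(1) by (simp add: mult.commute)
      ultimately have "a = c [^] s"
        using a(1) by (simp add: c_def int_pow_mult int_pow_pow)
      also have "\<dots> = f ((l \<otimes>\<^bsub>K\<^esub> inv\<^bsub>K\<^esub> k) [^]\<^bsub>K\<^esub> s)"
        unfolding c using kl by (simp add: f.hom_int_pow)
      finally show False
        using a(3) kl f.G.int_pow_closed f.G.m_closed f.G.inv_closed by blast
    qed
    then have i: "i = j"
      using ij prime_gt_0_nat[OF p] integer_mod_group_eqI by (metis dvd_diff_commute)
    then have "f k = f l"
      using eq' a(1) kl by simp
    then show "u = v"
      using i uv kl finj by (simp add: inj_on_eq_iff)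
  qed
  ultimately show ?thesis
    by (simp add: mon_def)
qed

lemma order_DirProd: "order (H \<times>\<times> K) = order H * order K"
  by (simp add: order_def DirProd_def card_cartesian_product)

lemma order_integer_mod_group: "order (integer_mod_group n) = n"
  by (simp add: order_def carrier_integer_mod_group)

lemma (in comm_group) extend_mon_if_order_less:
  assumes fin: "finite (carrier G)" and p: "Factorial_Ring.prime p"
    and exp: "\<And>x. x \<in> carrier G \<Longrightarrow> x [^] p = \<one>"
    and K: "group K" and f: "f \<in> mon K G" and less: "order K < order G"
  obtains g where "g \<in> mon (integer_mod_group p \<times>\<times> K) G"
proof -
  have "card (f ` carrier K) = order K"
    using f by (simp add: mon_def card_image order_def)
  then have "f ` carrier K \<noteq> carrier G"
    using less by (auto simp: order_def)
  moreover have "f ` carrier K \<subseteq> carrier G"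
    using f by (auto simp: mon_def hom_def)
  ultimately obtain a where "a \<in> carrier G" "a \<notin> f ` carrier K"
    by blast
  then show ?thesis
    using that extend_mon[OF K f p _ exp] by blast
qed

lemma (in group) mon_prime_exponent:
  assumes fin: "finite (carrier G)" and p: "Factorial_Ring.prime p"
    and exp: "\<And>x. x \<in> carrier G \<Longrightarrow> x [^] p = \<one>" and "order G > 1"
  obtains f where "f \<in> mon (integer_mod_group p) G"
proof -
  have "carrier G \<noteq> {\<one>}"
    using assms(4) by (auto simp: order_def)
  then obtain x where x: "x \<in> carrier G" "x \<noteq> \<one>"
    by blast
  have "ord x dvd p"
    using exp x pow_eq_id by blast
  moreover have "ord x \<noteq> 1"
    using x ord_eq_1 by blast
  ultimately have "ord x = p"
    using p by (metis prime_nat_iff)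
  then show ?thesis
    using that powers_mon[OF x(1)] prime_gt_0_nat[OF p] by blast
qed

lemma (in comm_group) iso_elementary_abelian_rank_2:
  assumes fin: "finite (carrier G)" and p: "Factorial_Ring.prime p"
    and exp: "\<And>x. x \<in> carrier G \<Longrightarrow> x [^] p = \<one>" and n: "order G = p * p"
  shows "G \<cong> integer_mod_group p \<times>\<times> integer_mod_group p"
proof -
  have p1: "p > 1"
    using p by (rule prime_gt_1_nat)
  have "order G > 1"
    unfolding n using p1 p1 by (rule less_1_mult)
  then obtain f where "f \<in> mon (integer_mod_group p) G"
    using mon_prime_exponent[OF fin p exp] by blast
  moreover have "order (integer_mod_group p) < order G"
    unfolding n order_integer_mod_group using p1 by simp
  ultimately obtain g where "g \<in> mon (integer_mod_group p \<times>\<times> integer_mod_group p) G"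
    using extend_mon_if_order_less[OF fin p exp group_integer_mod_group] by blast
  then show ?thesis
    using n by (intro iso_if_mon[OF fin]) (simp_all add: DirProd_group order_DirProd order_integer_mod_group)
qed

lemma (in comm_group) iso_elementary_abelian_rank_3:
  assumes fin: "finite (carrier G)" and p: "Factorial_Ring.prime p"
    and exp: "\<And>x. x \<in> carrier G \<Longrightarrow> x [^] p = \<one>" and n: "order G = p * (p * p)"
  shows "G \<cong> integer_mod_group p \<times>\<times> integer_mod_group p \<times>\<times> integer_mod_group p"
proof -
  let ?Z = "integer_mod_group p"
  have p1: "p > 1"
    using p by (rule prime_gt_1_nat)
  then have pp: "1 < p * p"
    using less_1_mult by blast
  have "order G > 1" "order ?Z < order G" "order (?Z \<times>\<times> ?Z) < order G"
    unfolding n order_DirProd order_integer_mod_group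
    using less_1_mult[OF p1 pp] p1 pp by simp_all
  note less = this
  obtain f where "f \<in> mon ?Z G"
    using mon_prime_exponent[OF fin p exp less(1)] by blast
  then obtain g where "g \<in> mon (?Z \<times>\<times> ?Z) G"
    using extend_mon_if_order_less[OF fin p exp group_integer_mod_group _ less(2)] by blast
  then obtain h where "h \<in> mon (?Z \<times>\<times> ?Z \<times>\<times> ?Z) G"
    using extend_mon_if_order_less[OF fin p exp _ _ less(3)]
      DirProd_group[OF group_integer_mod_group group_integer_mod_group] by blast
  then show ?thesis
    using n by (intro iso_if_mon[OF fin]) (simp_all add: DirProd_group order_DirProd order_integer_mod_group)
qed

lemma (in group) iso_cyclic_if_ord:
  assumes fin: "finite (carrier G)" and x: "x \<in> carrier G" "ord x = order G"
  shows "G \<cong> integer_mod_group (order G)"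
proof -
  have "order G > 0"
    using fin order_gt_0_iff_finite by blast
  then have "(\<lambda>i::int. x [^] i) \<in> mon (integer_mod_group (order G)) G"
    using powers_mon[OF x] by simp
  then show ?thesis
    by (intro iso_if_mon[OF fin]) (simp_all add: order_integer_mod_group)
qed

lemma (in group) iso_cyclic_if_prime_order:
  assumes fin: "finite (carrier G)" and p: "Factorial_Ring.prime (order G)"
  shows "G \<cong> integer_mod_group (order G)"
proof -
  have "carrier G \<noteq> {\<one>}"
    using prime_gt_1_nat[OF p] by (auto simp: order_def)
  then obtain x where x: "x \<in> carrier G" "x \<noteq> \<one>"
    by blast
  have "ord x dvd order G" "ord x \<noteq> 1"
    using x ord_dvd_group_order ord_eq_1 by blast+
  then have "ord x = order G"
    using p by (metis prime_nat_iff)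
  then show ?thesis
    using iso_cyclic_if_ord[OF fin x(1)] by blast
qed

lemma (in group) iso_cases_order_4:
  assumes fin: "finite (carrier G)" and n: "order G = 4"
  shows "G \<cong> integer_mod_group 4 \<or> G \<cong> integer_mod_group 2 \<times>\<times> integer_mod_group 2"
proof (cases "\<forall>x\<in>carrier G. x [^] (2::nat) = \<one>")
  case True
  then interpret comm_group G
    using comm_group_if_exponent_2 by blast
  show ?thesis
    using iso_elementary_abelian_rank_2[OF fin two_is_prime_nat] True n by auto
next
  case False
  then obtain x where x: "x \<in> carrier G" "x [^] (2::nat) \<noteq> \<one>"
    by blast
  have "ord x dvd 2 ^ 2"
    using ord_dvd_group_order[OF x(1)] n by simp
  then obtain i where i: "i \<le> 2" "ord x = 2 ^ i"
    using divides_primepow_nat[OF two_is_prime_nat] by blast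
  have "\<not> ord x dvd 2"
    using x pow_eq_id by blast
  then have "i \<noteq> 0" "i \<noteq> 1"
    using i(2) by (metis one_dvd power_0, metis dvd_refl power_one_right)
  then have "i = 2"
    using i(1) by linarith
  then have "ord x = order G"
    using i(2) n by simp
  then show ?thesis
    using iso_cyclic_if_ord[OF fin x(1)] n by simp
qed

lemma (in group) strong_CFS_imp_iso:
  assumes fin: "finite (carrier G)" and cfs: "strong_CFS G" and "order G \<noteq> 1"
  shows "(\<exists>p::nat. Factorial_Ring.prime p \<and> G \<cong> integer_mod_group p) \<or>
    G \<cong> integer_mod_group 4 \<or>
    G \<cong> integer_mod_group 2 \<times>\<times> integer_mod_group 2 \<or>
    G \<cong> integer_mod_group 2 \<times>\<times> integer_mod_group 2 \<times>\<times> integer_mod_group 2 \<or>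
    G \<cong> integer_mod_group 3 \<times>\<times> integer_mod_group 3"
proof -
  consider "Factorial_Ring.prime (order G)" | "order G = 4" | "order G = 8" | "order G = 9"
    using strong_CFS_order_cases[OF assms] by blast
  then show ?thesis
  proof cases
    case 1
    then show ?thesis
      using iso_cyclic_if_prime_order[OF fin] by blast
  next
    case 2
    then show ?thesis
      using iso_cases_order_4[OF fin] by blast
  next
    case 3
    then interpret comm_group G
      using comm_group_if_exponent_2 strong_CFS_order_8_exponent[OF fin cfs] by blast
    show ?thesis
      using iso_elementary_abelian_rank_3[OF fin two_is_prime_nat]
        strong_CFS_order_8_exponent[OF fin cfs 3] 3 by simp
  next
    case 4
    then interpret comm_group G
      using comm_group_if_order_9_exponent_3[OF fin] strong_CFS_order_9_exponent[OF fin cfs] by blast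
    have "Factorial_Ring.prime (3::nat)"
      by simp
    then show ?thesis
      using iso_elementary_abelian_rank_2[OF fin, of 3]
        strong_CFS_order_9_exponent[OF fin cfs 4] 4 by simp
  qed
qed

section \<open>The groups in the list have the property\<close>

lemma (in group) left_factor_if_trivial_card:
  assumes fin: "finite (carrier G)" and A: "A \<subseteq> carrier G" and "card A = 1 \<or> card A = order G"
  shows "left_factor G A"
  using assms(3)
proof
  assume "card A = 1"
  then obtain a where a: "A = {a}"
    using card_1_singletonE by blast
  then have "A = (\<lambda>h. a \<otimes> h) ` {\<one>}"
    using A by simp
  then show ?thesis
    using left_factor_translate_subgroup[OF fin triv_subgroup, of a] a A by simp
next
  assume "card A = order G"
  then have "A = carrier G"
    using card_subset_eq[OF fin A] by (simp add: order_def)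
  moreover have "(\<lambda>h. \<one> \<otimes> h) ` carrier G = carrier G"
    by simp
  ultimately show ?thesis
    using left_factor_translate_subgroup[OF fin subgroup_self, of \<one>] by simp
qed

text \<open>
  A set \<open>D\<close> smaller than the group that contains all quotients of elements of \<open>A\<close> misses some \<open>d\<close>.
  Quotients are closed under inversion, so \<open>inv d\<close> is not a quotient either, and nontrivial quotients
  of elements of \<open>{\<one>, d}\<close> are \<open>d\<close> and \<open>inv d\<close>. If \<open>p = 3\<close>, the same is true of \<open>{\<one>, d, inv d}\<close>,
  which is a subgroup as \<open>d\<close> has order 3.
\<close>

lemma (in group) left_factor_if_few_differences:
  assumes fin: "finite (carrier G)" and A: "A \<subseteq> carrier G" and p: "p = 2 \<or> p = 3"
    and exp: "p = 3 \<Longrightarrow> (\<And>x. x \<in> carrier G \<Longrightarrow> x [^] (3::nat) = \<one>)"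
    and card: "card A * p = order G"
    and D: "finite D" "card D < order G"
      "\<And>a a'. \<lbrakk>a \<in> A; a' \<in> A\<rbrakk> \<Longrightarrow> inv a \<otimes> a' \<in> D"
  shows "left_factor G A"
proof -
  have "\<not> carrier G \<subseteq> D"
    using card_mono[OF D(1), of "carrier G"] D(2) by (auto simp: order_def)
  then obtain d where d: "d \<in> carrier G" "d \<notin> D"
    by blast
  have notD: "inv a \<otimes> a' \<noteq> d" if "a \<in> A" "a' \<in> A" for a a'
    using that D d by blast
  have notD': "inv a \<otimes> a' \<noteq> inv d" if "a \<in> A" "a' \<in> A" for a a'
  proof
    assume "inv a \<otimes> a' = inv d"
    then have "inv (inv a \<otimes> a') = d"
      using d by simp
    then have "inv a' \<otimes> a = d"
      using that A by (simp add: inv_mult_group subset_iff)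
    then show False
      using notD that by blast
  qed
  have "A \<noteq> {}"
    using card fin order_gt_0_iff_finite by auto
  then obtain a0 where a0: "a0 \<in> A" "a0 \<in> carrier G"
    using A by blast
  have d1: "d \<noteq> \<one>"
    using notD[OF a0(1) a0(1)] a0(2) by auto
  show ?thesis
    using p
  proof
    assume p2: "p = 2"
    show ?thesis
    proof (rule left_factor_if_differences_avoid[OF fin A])
      show "{\<one>, d} \<subseteq> carrier G"
        using d by simp
      show "card A * card {\<one>, d} = order G"
        using card p2 d1 by simp
      show "inv a \<otimes> a' \<noteq> b \<otimes> inv b'"
        if "a \<in> A" "a' \<in> A" "b \<in> {\<one>, d}" "b' \<in> {\<one>, d}" "b \<noteq> b'" for a a' b b'
        using that(3-5) notD[OF that(1,2)] notD'[OF that(1,2)] d by auto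
    qed
  next
    assume p3: "p = 3"
    then have "d [^] (3::nat) = \<one>"
      using exp d by blast
    then have d3: "d \<otimes> d \<otimes> d = \<one>"
      using d by (simp add: numeral_3_eq_3)
    have dd: "d \<otimes> d = inv d"
      using d3 d by (simp add: inv_equality)
    have invd: "inv d \<noteq> \<one>" "inv d \<noteq> d"
      using d1 d3 d dd by auto
    show ?thesis
    proof (rule left_factor_if_differences_avoid[OF fin A])
      show "{\<one>, d, inv d} \<subseteq> carrier G"
        using d by simp
      show "card A * card {\<one>, d, inv d} = order G"
        using card p3 d1 invd by auto
      have "inv d \<otimes> inv d = d"
        using d dd by (metis inv_inv inv_mult_group)
      then show "inv a \<otimes> a' \<noteq> b \<otimes> inv b'"
        if "a \<in> A" "a' \<in> A" "b \<in> {\<one>, d, inv d}" "b' \<in> {\<one>, d, inv d}" "b \<noteq> b'" for a a' b b'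
        using that(3-5) notD[OF that(1,2)] notD'[OF that(1,2)] d dd by auto
    qed
  qed
qed

lemma (in group) strong_CFS_if_prime_order:
  assumes fin: "finite (carrier G)" and "Factorial_Ring.prime (order G)"
  shows "strong_CFS G"
  unfolding strong_CFS_def lagrange_subset_def
  using left_factor_if_trivial_card[OF fin] assms(2) by (metis prime_nat_iff)

text \<open>
  Two elements have at most three quotients.
\<close>

lemma (in group) strong_CFS_if_order_4:
  assumes fin: "finite (carrier G)" and n: "order G = 4"
  shows "strong_CFS G"
  unfolding strong_CFS_def lagrange_subset_def
proof (intro allI impI, elim conjE)
  fix A assume A: "A \<subseteq> carrier G" and "card A dvd order G"
  then have "card A dvd 2 ^ 2"
    using n by simp
  then obtain i where i: "i \<le> 2" "card A = 2 ^ i"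
    using divides_primepow_nat[OF two_is_prime_nat] by blast
  then consider "card A = 1 \<or> card A = order G" | "card A = 2"
    using n by (auto simp: numeral_2_eq_2 le_Suc_eq)
  then show "left_factor G A"
  proof cases
    case 1
    then show ?thesis
      using left_factor_if_trivial_card[OF fin A] by blast
  next
    case 2
    then obtain a b where ab: "A = {a, b}"
      by (auto simp: card_2_iff)
    let ?D = "set [\<one>, inv a \<otimes> b, inv b \<otimes> a]"
    have D: "card ?D < order G"
      unfolding n by (rule le_less_trans[OF card_length]) simp
    show ?thesis
      by (rule left_factor_if_few_differences[OF fin A, of 2 ?D]) (use D 2 n ab A in auto)
  qed
qed

text \<open>
  Sets of size 2 are cosets. A set of size 4 has at most 1 + 6 = 7 quotients, because a quotient
  does not change when its two elements are interchanged.
\<close>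

lemma (in group) strong_CFS_if_order_8_exponent_2:
  assumes fin: "finite (carrier G)" and n: "order G = 8"
    and exp: "\<And>x. x \<in> carrier G \<Longrightarrow> x [^] (2::nat) = \<one>"
  shows "strong_CFS G"
  unfolding strong_CFS_def lagrange_subset_def
proof (intro allI impI, elim conjE)
  fix A assume A: "A \<subseteq> carrier G" and "card A dvd order G"
  interpret comm_group G
    using comm_group_if_exponent_2 exp by blast
  have inv: "inv x = x" if "x \<in> carrier G" for x
    using exp[OF that] that by (intro inv_equality) (auto simp: numeral_2_eq_2)
  have "card A dvd 2 ^ 3"
    using n \<open>card A dvd order G\<close> by simp
  then obtain i where i: "i \<le> 3" "card A = 2 ^ i"
    using divides_primepow_nat[OF two_is_prime_nat] by blast
  then have "i = 0 \<or> i = 1 \<or> i = 2 \<or> i = 3"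
    by linarith
  then consider "card A = 1 \<or> card A = order G" | "card A = 2" | "card A = 4"
    using i n by auto
  then show "left_factor G A"
  proof cases
    case 1
    then show ?thesis
      using left_factor_if_trivial_card[OF fin A] by blast
  next
    case 2
    then obtain a b where ab: "A = {a, b}"
      by (auto simp: card_2_iff)
    have car: "a \<in> carrier G" "b \<in> carrier G"
      using ab A by auto
    define c where "c = inv a \<otimes> b"
    have c: "c \<in> carrier G" "inv c = c" "a \<otimes> c = b"
      using car inv[of c] by (auto simp: c_def m_assoc[symmetric])
    have "c \<otimes> c = \<one>"
      using c by (metis r_inv)
    then have sub: "subgroup {\<one>, c} G"
      using c by (intro subgroupI) auto
    have "A = (\<lambda>h. a \<otimes> h) ` {\<one>, c}"
      using ab c car by simp
    then show ?thesis
      using left_factor_translate_subgroup[OF fin sub car(1)] by simp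
  next
    case 3
    then obtain a b c d where abcd: "A = {a, b, c, d}"
      by (auto simp: card_Suc_eq numeral_eq_Suc)
    let ?D = "set [\<one>, a \<otimes> b, a \<otimes> c, a \<otimes> d, b \<otimes> c, b \<otimes> d, c \<otimes> d]"
    have D: "card ?D < order G"
      unfolding n by (rule le_less_trans[OF card_length]) simp
    have car: "a \<in> carrier G" "b \<in> carrier G" "c \<in> carrier G" "d \<in> carrier G"
      using abcd A by auto
    have diff: "inv u \<otimes> v \<in> ?D" if "u \<in> A" "v \<in> A" for u v
    proof -
      have uv: "u \<in> carrier G" "v \<in> carrier G"
        using that A by auto
      then have "u = v \<Longrightarrow> inv u \<otimes> v = \<one>" "inv u \<otimes> v = u \<otimes> v" "u \<otimes> v = v \<otimes> u"
        by (simp, simp only: inv) (rule m_comm[OF uv])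
      then show ?thesis
        using that unfolding abcd by auto
    qed
    show ?thesis
      by (rule left_factor_if_few_differences[OF fin A, of 2 ?D]) (use D 3 n diff in simp_all)
  qed
qed

text \<open>
  Three elements have at most 1 + 6 = 7 quotients.
\<close>

lemma (in group) strong_CFS_if_order_9_exponent_3:
  assumes fin: "finite (carrier G)" and n: "order G = 9"
    and exp: "\<And>x. x \<in> carrier G \<Longrightarrow> x [^] (3::nat) = \<one>"
  shows "strong_CFS G"
  unfolding strong_CFS_def lagrange_subset_def
proof (intro allI impI, elim conjE)
  fix A assume A: "A \<subseteq> carrier G" and "card A dvd order G"
  then have "card A dvd 3 ^ 2"
    using n by simp
  then obtain i where i: "i \<le> 2" "card A = 3 ^ i"
    using divides_primepow_nat[of 3 "card A" 2] by auto
  then have "i = 0 \<or> i = 1 \<or> i = 2"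
    by linarith
  then consider "card A = 1 \<or> card A = order G" | "card A = 3"
    using i n by auto
  then show "left_factor G A"
  proof cases
    case 1
    then show ?thesis
      using left_factor_if_trivial_card[OF fin A] by blast
  next
    case 2
    then obtain a b c where abc: "A = {a, b, c}"
      by (auto simp: card_3_iff)
    let ?D = "set [\<one>, inv a \<otimes> b, inv b \<otimes> a, inv a \<otimes> c, inv c \<otimes> a, inv b \<otimes> c, inv c \<otimes> b]"
    have D: "card ?D < order G"
      unfolding n by (rule le_less_trans[OF card_length]) simp
    have diff: "inv u \<otimes> v \<in> ?D" if "u \<in> A" "v \<in> A" for u v
    proof -
      have "u = v \<Longrightarrow> inv u \<otimes> v = \<one>"
        using that A by auto
      then show ?thesis
        using that unfolding abc by auto
    qed
    show ?thesis
      by (rule left_factor_if_few_differences[OF fin A, of 3 ?D]) (use D 2 n diff exp in simp_all)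
  qed
qed

lemma pow_DirProd:
  "(x, y) [^]\<^bsub>H \<times>\<times> K\<^esub> (n::nat) = (x [^]\<^bsub>H\<^esub> n, y [^]\<^bsub>K\<^esub> n)"
  by (induction n) (simp_all add: nat_pow_def DirProd_def)

lemma (in group) exponent_iso:
  fixes n :: nat
  assumes iso: "G \<cong> K" and K: "group K" and exp: "\<And>k. k \<in> carrier K \<Longrightarrow> k [^]\<^bsub>K\<^esub> n = \<one>\<^bsub>K\<^esub>"
    and x: "x \<in> carrier G"
  shows "x [^] n = \<one>"
proof -
  obtain f where f: "f \<in> hom G K" "inj_on f (carrier G)" "f ` carrier G = carrier K"
    using iso by (auto simp: is_iso_def iso_def bij_betw_def)
  interpret f: group_hom G K f
    using f K is_group by (simp add: group_hom_def group_hom_axioms_def)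
  have "f (x [^] n) = f \<one>"
    using exp[of "f x"] x by (simp add: f.hom_nat_pow)
  then show ?thesis
    by (rule inj_onD[OF f(2)]) (use x in auto)
qed

theorem theorem1:
  fixes G :: "('a, 'b) monoid_scheme"
  assumes "group G" and "finite (carrier G)" and "\<not> trivial_group G"
  shows "strong_CFS G \<longleftrightarrow>
    (\<exists>p::nat. Factorial_Ring.prime p \<and> G \<cong> integer_mod_group p) \<or>
    G \<cong> integer_mod_group 4 \<or>
    G \<cong> integer_mod_group 2 \<times>\<times> integer_mod_group 2 \<or>
    G \<cong> integer_mod_group 2 \<times>\<times> integer_mod_group 2 \<times>\<times> integer_mod_group 2 \<or>
    G \<cong> integer_mod_group 3 \<times>\<times> integer_mod_group 3"
    (is "_ \<longleftrightarrow> ?list")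
proof
  interpret group G by (rule assms(1))
  {
    assume "strong_CFS G"
    moreover have "order G \<noteq> 1"
    proof
      assume "order G = 1"
      then have "carrier G = {\<one>\<^bsub>G\<^esub>}"
        using card_1_singletonE one_closed unfolding order_def by (metis singletonD)
      then show False
        using assms(1,3) by (simp add: trivial_group_def)
    qed
    ultimately show ?list
      using strong_CFS_imp_iso[OF assms(2)] by blast
  }
  assume ?list
  then show "strong_CFS G"
  proof (elim disjE exE conjE)
    fix p :: nat
    assume "Factorial_Ring.prime p" "G \<cong> integer_mod_group p"
    then show ?thesis
      using strong_CFS_if_prime_order[OF assms(2)] iso_same_card
      by (metis order_def order_integer_mod_group)
  next
    assume "G \<cong> integer_mod_group 4"
    then show ?thesis
      using strong_CFS_if_order_4[OF assms(2)] iso_same_card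
      by (metis order_def order_integer_mod_group)
  next
    assume "G \<cong> integer_mod_group 2 \<times>\<times> integer_mod_group 2"
    from iso_same_card[OF this] have "order G = 4"
      unfolding order_def[symmetric] by (simp add: order_DirProd order_integer_mod_group)
    then show ?thesis
      by (rule strong_CFS_if_order_4[OF assms(2)])
  next
    assume iso: "G \<cong> integer_mod_group 2 \<times>\<times> integer_mod_group 2 \<times>\<times> integer_mod_group 2"
    have "order G = 8"
      using iso_same_card[OF iso] unfolding order_def[symmetric]
      by (simp add: order_DirProd order_integer_mod_group)
    moreover have "x [^]\<^bsub>G\<^esub> (2::nat) = \<one>\<^bsub>G\<^esub>" if "x \<in> carrier G" for x
      using that by (rule exponent_iso[OF iso, rotated 2])
        (auto simp: DirProd_group pow_DirProd)
    ultimately show ?thesis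
      by (rule strong_CFS_if_order_8_exponent_2[OF assms(2)])
  next
    assume iso: "G \<cong> integer_mod_group 3 \<times>\<times> integer_mod_group 3"
    have "order G = 9"
      using iso_same_card[OF iso] unfolding order_def[symmetric]
      by (simp add: order_DirProd order_integer_mod_group)
    moreover have "x [^]\<^bsub>G\<^esub> (3::nat) = \<one>\<^bsub>G\<^esub>" if "x \<in> carrier G" for x
      using that by (rule exponent_iso[OF iso, rotated 2])
        (auto simp: DirProd_group pow_DirProd)
    ultimately show ?thesis
      by (rule strong_CFS_if_order_9_exponent_3[OF assms(2)])
  qed
qed

end
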